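(* Let $F_2=\{a_1,a_2\}$ with $0<a_1<a_2<\pi$, and let $q,\tilde q\in L^2(0,\pi)$. Define $G_2(\rho)=\sin(\rho a_1)+\sin(\rho a_2)$ and let $Z(G_2)$ denote the set of zeros of $G_2$. Suppose that $Z(G_2)\cap\mathbb N=\emptyset$ and that $\Lambda(q,F_2)=\Lambda(\tilde q,F_2)$. Then $q(x)=\tilde q(x)$ for almost every $x\in(0,\pi)$.
   Context: Here $\mathbb N=\{1,2,3,\dots\}$, and potentials may be complex-valued. For $q\in L^2(0,\pi)$ and $F_2=\{a_1,a_2\}$, $L(q,F_2,0,0)$ denotes the boundary value problem $$-y''(x)+q(x)\bigl(y(a_1)+y(a_2)\bigr)=\lambda y(x),\quad 0<x<\pi,\qquad y(0)=0=y(\pi),$$ where $\lambda\in\mathbb C$ is the spectral parameter. Write $\lambda=\rho^2$ and, for $x\in[0,\pi]$, set $$s(x)=\frac{\sin\rho x}{\rho},\qquad I(x)=\int_0^{x}q(t)\frac{\sin\rho(x-t)}{\rho}\,dt$$ (even entire functions of $\rho$, hence entire functions of $\lambda$; the values at $\rho=0$ are understood by continuity). The characteristic function of $L(q,F_2,0,0)$ is the entire function $$\triangle_2(\lambda)=\det\begin{bmatrix} s(a_1)& I(a_1)-1 & I(a_1)\\ s(a_2)& I(a_2)& I(a_2)-1\\ s(\pi)& I(\pi)& I(\pi)\end{bmatrix}.$$ A number $\lambda$ is an eigenvalue of $L(q,F_2,0,0)$ if and only if $\triangle_2(\lambda)=0$. $\Lambda(q,F_2)=\{\lambda_m\}_{m\ge1}$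 denotes the eigenvalues of $L(q,F_2,0,0)$, counted with multiplicity as zeros of $\triangle_2$; equality $\Lambda(q,F_2)=\Lambda(\tilde q,F_2)$ means equality of these collections counted with multiplicity. *)

theory Defs
  imports "HOL-Complex_Analysis.Complex_Analysis"
begin

definition L2_0_pi :: "(real \<Rightarrow> complex) \<Rightarrow> bool" where
  "L2_0_pi q \<longleftrightarrow>
     q \<in> borel_measurable (lebesgue_on {0<..<pi}) \<and>
     integrable (lebesgue_on {0<..<pi}) (\<lambda>x. (norm (q x))\<^sup>2)"

text \<open>
  Solutions are understood in the Caratheodory sense: \<open>y\<close> is differentiable on the closed
  interval, \<open>y'\<close> is absolutely continuous (expressed as being the indefinite integral of an
  integrable \<open>y''\<close>), and the equation holds almost everywhere.  By the equation, such a
  \<open>y''\<close> is then automatically square integrable when \<open>q\<close> is.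
\<close>
definition bvp_solution ::
  "(real \<Rightarrow> complex) \<Rightarrow> real \<Rightarrow> real \<Rightarrow> complex \<Rightarrow> (real \<Rightarrow> complex) \<Rightarrow> bool" where
  "bvp_solution q a1 a2 l y \<longleftrightarrow>
     (\<exists>y' y''.
        (\<forall>x\<in>{0..pi}. (y has_vector_derivative y' x) (at x within {0..pi})) \<and>
        set_integrable lebesgue {0<..<pi} y'' \<and>
        (\<forall>x\<in>{0..pi}. y' x = y' 0 + (LINT t:{0<..<x}|lebesgue. y'' t)) \<and>
        (AE x in lebesgue_on {0<..<pi}. - y'' x + q x * (y a1 + y a2) = l * y x)) \<and>
     y 0 = 0 \<and> y pi = 0"

definition eigenvalue :: "(real \<Rightarrow> complex) \<Rightarrow> real \<Rightarrow> real \<Rightarrow> complex \<Rightarrow> bool" where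
  "eigenvalue q a1 a2 l \<longleftrightarrow>
     (\<exists>y. bvp_solution q a1 a2 l y \<and> (\<exists>x\<in>{0..pi}. y x \<noteq> 0))"

definition sfun :: "complex \<Rightarrow> real \<Rightarrow> complex" where
  "sfun \<rho> x = (if \<rho> = 0 then of_real x else sin (\<rho> * of_real x) / \<rho>)"

definition Ifun :: "(real \<Rightarrow> complex) \<Rightarrow> complex \<Rightarrow> real \<Rightarrow> complex" where
  "Ifun q \<rho> x = (LINT t:{0<..<x}|lebesgue. q t * sfun \<rho> (x - t))"

text \<open>
  Both \<open>sfun\<close> and \<open>Ifun\<close> are even in \<open>\<rho>\<close>, so the choice of the square root of
  the spectral parameter is immaterial.
\<close>
definition char_fun :: "(real \<Rightarrow> complex) \<Rightarrow> real \<Rightarrow> real \<Rightarrow> complex \<Rightarrow> complex" where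
  "char_fun q a1 a2 l =
     (let \<rho> = csqrt l; s = sfun \<rho>; I = Ifun q \<rho> in
      det (vector [vector [s a1, I a1 - 1, I a1],
                   vector [s a2, I a2, I a2 - 1],
                   vector [s pi, I pi, I pi]] :: complex^3^3))"

text \<open>
  The spectrum as a collection with multiplicities is encoded by its multiplicity function:
  the multiplicity of an eigenvalue is its order as a zero of the characteristic function, and
  points that are not eigenvalues get multiplicity 0.
\<close>
definition spectrum_mult :: "(real \<Rightarrow> complex) \<Rightarrow> real \<Rightarrow> real \<Rightarrow> complex \<Rightarrow> nat" where
  "spectrum_mult q a1 a2 l =
     (if eigenvalue q a1 a2 l then nat (zorder (char_fun q a1 a2) l) else 0)"

definition G2 :: "real \<Rightarrow> real \<Rightarrow> complex \<Rightarrow> complex" where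
  "G2 a1 a2 \<rho> = sin (\<rho> * of_real a1) + sin (\<rho> * of_real a2)"

end

theory Submission
  imports Defs
begin

text \<open>
  Write \<open>s x = sin (\<rho> x) / \<rho>\<close> and \<open>I x\<close> for the convolution of the potential with \<open>s\<close> over
  \<open>(0, x)\<close>.  Expanding the determinant gives, at \<open>\<lambda> = \<rho>\<^sup>2\<close>,
  \<open>\<Delta> \<lambda> = s \<pi> + (s a1 * I \<pi> - s \<pi> * I a1) + (s a2 * I \<pi> - s \<pi> * I a2)\<close>.
  The two products in one summand can separately have exponential type larger than \<open>\<pi>\<close>, but
  \<open>sin (\<rho> a) sin (\<rho> (\<pi> - t)) - sin (\<rho> \<pi>) sin (\<rho> (a - t)) = sin (\<rho> (\<pi> - a)) sin (\<rho> t)\<close>,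
  so that their difference is \<open>O (exp (\<pi> \<bar>Im \<rho>\<bar>) / \<bar>\<rho>\<bar>\<^sup>2)\<close> (lemma \<open>interaction_bound\<close>).  It is therefore
  dominated by \<open>s \<pi>\<close> on the boundaries of the squares \<open>\<bar>Re \<rho>\<bar>, \<bar>Im \<rho>\<bar> \<le> N + 1/2\<close>, where
  \<open>\<bar>sin (\<rho> \<pi>)\<bar> \<ge> exp (\<pi> \<bar>Im \<rho>\<bar>) / 4\<close>.

  If two such entire functions have the same zeros with the same multiplicities, their quotient is
  entire and tends to 1 uniformly on these boundaries; by the maximum principle it is identically 1.
  This determines the characteristic function from its zeros without any factorization theorem
  (lemma \<open>entire_eq_by_zeros_and_asymptotics\<close>).

  At \<open>\<rho> = n\<close> the terms containing \<open>s \<pi>\<close> vanish and \<open>\<Delta> (n\<^sup>2) = G2(n) / n * I \<pi>\<close>.  As \<open>G2(n) \<noteq> 0\<close>,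
  equality of two characteristic functions gives equality of all sine coefficients of the two
  potentials, and the system \<open>sin (n t)\<close>, \<open>n \<ge> 1\<close>, is total (lemma \<open>sine_system_total\<close>).

  One more link is needed: the spectrum records the order of a zero of \<open>\<Delta>\<close> only at eigenvalues, so
  every zero of \<open>\<Delta>\<close> must be shown to be an eigenvalue.  A kernel vector of the matrix gives an
  eigenfunction (lemma \<open>eigenvalueI_char_fun_zero\<close>).
\<close>

section \<open>Borel representatives and Volterra convolutions\<close>

definition volterra :: "(real \<Rightarrow> complex) \<Rightarrow> (real \<Rightarrow> complex) \<Rightarrow> real \<Rightarrow> complex" where
  "volterra p k x = (LINT t:{0<..<x}|lborel. p t * k (x - t))"

text \<open>
  Passing from a Lebesgue measurable potential to a Borel measurable one makes the product
  measurability needed for Fubini's theorem available.  Integrability on the bounded interval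
  follows from \<open>\<bar>q\<bar> \<le> 1 + \<bar>q\<bar>\<^sup>2\<close>.
\<close>
lemma L2_borel_representative:
  assumes "L2_0_pi q"
  obtains p where "p \<in> borel_measurable borel" "integrable lborel p"
    "AE x in lebesgue_on {0<..<pi}. q x = p x"
proof -
  define f where "f x = indicator {0<..<pi} x *\<^sub>R q x" for x
  have qm: "q \<in> borel_measurable (lebesgue_on {0<..<pi})"
    and q2: "integrable (lebesgue_on {0<..<pi}) (\<lambda>x. (norm (q x))\<^sup>2)"
    using assms by (auto simp: L2_0_pi_def)
  have "integrable (lebesgue_on {0<..<pi}) (\<lambda>x. 1 + (norm (q x))\<^sup>2)"
  proof (rule Bochner_Integration.integrable_add[OF _ q2])
    interpret finite_measure "lebesgue_on {0<..<pi}"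
      by (rule finite_measure_lebesgue_on) auto
    show "integrable (lebesgue_on {0<..<pi}) (\<lambda>x. 1::real)" by simp
  qed
  then have qi: "integrable (lebesgue_on {0<..<pi}) q"
  proof (rule Bochner_Integration.integrable_bound[OF _ qm], intro AE_I2)
    fix x :: real
    show "norm (q x) \<le> norm (1 + (norm (q x))\<^sup>2)"
      using zero_le_power2[of "norm (q x) - 1"] zero_le_power2[of "norm (q x)"]
      by (simp add: power2_eq_square algebra_simps) (smt (verit) norm_ge_zero)
  qed
  then have fi: "integrable lebesgue f"
    unfolding f_def by (simp add: integrable_restrict_space set_integrable_def)
  then have fm: "f \<in> borel_measurable (completion lborel)"
    by auto
  obtain g where g: "g \<in> borel_measurable lborel" "AE x in lborel. Re (f x) = g x"
    using completion_ex_borel_measurable_real[of "\<lambda>x. Re (f x)" lborel] fm by (auto simp: borel_measurable_complex_iff)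
  obtain h where h: "h \<in> borel_measurable lborel" "AE x in lborel. Im (f x) = h x"
    using completion_ex_borel_measurable_real[of "\<lambda>x. Im (f x)" lborel] fm by (auto simp: borel_measurable_complex_iff)
  define p where "p x = Complex (g x) (h x)" for x
  have pm: "p \<in> borel_measurable borel"
    using g h by (simp add: borel_measurable_complex_iff p_def)
  have ae: "AE x in lborel. f x = p x"
    using g(2) h(2) by eventually_elim (simp add: p_def complex_eq_iff)
  then have ae': "AE x in lebesgue. f x = p x"
    by (rule AE_completion)
  have "integrable lebesgue p"
    using fi by (rule integrable_cong_AE_imp) (use ae' pm in \<open>auto intro: measurable_completion\<close>)
  then have "integrable lborel p"
    using pm by (simp add: integrable_completion)
  moreover have "AE x in lebesgue_on {0<..<pi}. q x = p x"
    unfolding AE_restrict_space_iff[of "{0<..<pi}" lebesgue, simplified]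
    using ae' by eventually_elim (auto simp: f_def)
  ultimately show ?thesis using that pm by blast
qed

lemma Ifun_eq_volterra:
  assumes pm: "p \<in> borel_measurable borel" and ae: "AE x in lebesgue_on {0<..<pi}. q x = p x"
    and x: "x \<le> pi" and r: "continuous_on UNIV (sfun \<rho>)"
  shows "Ifun q \<rho> x = volterra p (sfun \<rho>) x"
proof -
  let ?f = "\<lambda>t. indicator {0<..<x} t *\<^sub>R (p t * sfun \<rho> (x - t))"
  have [measurable]: "sfun \<rho> \<in> borel_measurable borel"
    using r by (rule borel_measurable_continuous_onI)
  have m: "?f \<in> borel_measurable lborel"
    using pm by simp
  have ae': "AE t in lebesgue. t \<in> {0<..<pi} \<longrightarrow> q t = p t"
    using ae unfolding AE_restrict_space_iff[of "{0<..<pi}" lebesgue, simplified] by simp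
  have ae2: "AE t in lebesgue. ?f t = indicator {0<..<x} t *\<^sub>R (q t * sfun \<rho> (x - t))"
    using ae' by eventually_elim (use x in \<open>auto simp: indicator_def\<close>)
  have "Ifun q \<rho> x = integral\<^sup>L lebesgue ?f"
    unfolding Ifun_def set_lebesgue_integral_def
  proof (rule integral_cong_AE)
    show m': "?f \<in> borel_measurable lebesgue"
      using m by (rule measurable_completion)
    show "(\<lambda>t. indicator {0<..<x} t *\<^sub>R (q t * sfun \<rho> (x - t))) \<in> borel_measurable lebesgue"
      using m' ae2 by (rule borel_measurable_AE)
    show "AE t in lebesgue. indicator {0<..<x} t *\<^sub>R (q t * sfun \<rho> (x - t)) = ?f t"
      using ae2 by eventually_elim (rule sym)
  qed
  also have "\<dots> = integral\<^sup>L lborel ?f"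
    using m by (rule integral_completion)
  finally show ?thesis
    by (simp add: volterra_def set_lebesgue_integral_def)
qed

lemma continuous_kernel_bounded:
  fixes k :: "real \<Rightarrow> complex"
  assumes k: "continuous_on UNIV k"
  obtains M where "0 \<le> M" "\<And>u. u \<in> {0..x} \<Longrightarrow> norm (k u) \<le> M"
proof -
  have "compact (k ` {0..x})"
    by (rule compact_continuous_image) (auto intro: continuous_on_subset[OF k] compact_Icc)
  then have "bounded (k ` {0..x})"
    by (rule compact_imp_bounded)
  then obtain M where "M > 0" "\<forall>z\<in>k ` {0..x}. norm z \<le> M"
    unfolding bounded_pos by blast
  then show ?thesis using that[of M] by auto
qed

lemma volterra_integrand_integrable:
  fixes k :: "real \<Rightarrow> complex"
  assumes pi: "integrable lborel p" and k: "continuous_on UNIV k"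
  shows "set_integrable lborel {0<..<x} (\<lambda>t. p t * k (x - t))"
proof -
  have [measurable]: "k \<in> borel_measurable borel"
    using k by (rule borel_measurable_continuous_onI)
  have [measurable]: "p \<in> borel_measurable borel"
    using pi by auto
  obtain M where M: "0 \<le> M" "\<And>u. u \<in> {0..x} \<Longrightarrow> norm (k u) \<le> M"
    using continuous_kernel_bounded[OF k] by blast
  show ?thesis
    unfolding set_integrable_def
  proof (rule Bochner_Integration.integrable_bound)
    show "integrable lborel (\<lambda>t. p t * of_real M)"
      using pi by simp
    have "norm (indicator {0<..<x} t *\<^sub>R (p t * k (x - t))) \<le> norm (p t * of_real M)" for t
      using order_trans[OF M(2)[of "x - t"] abs_ge_self]
      by (auto simp: indicator_def norm_mult intro!: mult_left_mono)
    then show "AE t in lborel. norm (indicator {0<..<x} t *\<^sub>R (p t * k (x - t))) \<le> norm (p t * of_real M)"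
      by (intro AE_I2)
  qed simp
qed

lemma integral_Ioo_eq_increment:
  fixes K k :: "real \<Rightarrow> complex"
  assumes "\<And>x. (K has_vector_derivative k x) (at x)" "continuous_on UNIV k" "a \<le> b"
  shows "(LINT u:{a<..<b}|lborel. k u) = K b - K a"
proof -
  have "(LBINT u=ereal a..ereal b. k u) = K b - K a"
    by (rule interval_integral_FTC_finite)
       (use assms in \<open>auto intro: continuous_on_subset has_vector_derivative_at_within\<close>)
  then show ?thesis
    using assms(3) by (simp add: interval_integral_Ioo)
qed

text \<open>
  Integrating the kernel commutes with convolving: this is Fubini's theorem on the triangle
  \<open>0 < t < u < x\<close>.  For \<open>K = sfun \<rho>\<close> it gives the derivative of the convolution; for the cosine kernel
  it writes that derivative as an indefinite integral, although a pointwise second derivative need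
  not exist for a merely integrable \<open>p\<close>.
\<close>
lemma volterra_primitive:
  fixes K k :: "real \<Rightarrow> complex"
  assumes pi: "integrable lborel p"
    and K: "\<And>x. (K has_vector_derivative k x) (at x)" and k: "continuous_on UNIV k"
  shows "set_integrable lborel {0<..<x} (volterra p k)"
    and "volterra p K x = K 0 * (LINT t:{0<..<x}|lborel. p t) + (LINT u:{0<..<x}|lborel. volterra p k u)"
proof -
  define f where "f t u = indicator {0<..<x} t *\<^sub>R (indicator {t<..<x} u *\<^sub>R (p t * k (u - t)))" for t u
  have [measurable]: "k \<in> borel_measurable borel"
    using k by (rule borel_measurable_continuous_onI)
  have [measurable]: "p \<in> borel_measurable borel"
    using pi by auto
  obtain M where M: "0 \<le> M" "\<And>u. u \<in> {0..x} \<Longrightarrow> norm (k u) \<le> M"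
    using continuous_kernel_bounded[OF k] by blast
  have fm [measurable]: "case_prod f \<in> borel_measurable (lborel \<Otimes>\<^sub>M lborel)"
  proof -
    have "case_prod f = (\<lambda>z. if 0 < fst z \<and> fst z < snd z \<and> snd z < x then p (fst z) * k (snd z - fst z) else 0)"
      by (auto simp: f_def fun_eq_iff indicator_def)
    then show ?thesis by simp
  qed
  have bound: "norm (f t u) \<le> norm (p t) * M * indicator {0..x} u" for t u
    using M(1) M(2)[of "u - t"] by (auto simp: f_def indicator_def norm_mult intro!: mult_left_mono)
  have int: "integrable (lborel \<Otimes>\<^sub>M lborel) (case_prod f)"
  proof (rule Bochner_Integration.integrable_bound)
    show "integrable (lborel \<Otimes>\<^sub>M lborel) (\<lambda>(t, u). norm (p t) * (M * indicator {0..x} u))"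
    proof (rule lborel_pair.Fubini_integrable)
      have "set_integrable lborel {0..x} (\<lambda>u. M)"
        by (rule borel_integrable_atLeastAtMost') simp
      then have I: "integrable lborel (\<lambda>u. M * indicator {0..x} u)"
        by (simp add: set_integrable_def mult.commute)
      show "AE t in lborel. integrable lborel (\<lambda>u. case (t, u) of (t, u) \<Rightarrow> norm (p t) * (M * indicator {0..x} u))"
        using I by (intro AE_I2) (auto intro!: integrable_mult_right)
      have "integrable lborel (\<lambda>t. norm (p t) * (\<integral>u. norm (M * indicator {0..x} u) \<partial>lborel))"
        using pi by (intro integrable_mult_left integrable_norm)
      then show "integrable lborel (\<lambda>t. \<integral>u. norm (case (t, u) of (t, u) \<Rightarrow> norm (p t) * (M * indicator {0..x} u)) \<partial>lborel)"
        by (simp add: norm_mult abs_mult)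
    qed measurable
    show "AE z in lborel \<Otimes>\<^sub>M lborel. norm (case_prod f z) \<le>
        norm (case z of (t, u) \<Rightarrow> norm (p t) * (M * indicator {0..x} u))"
      using bound order_trans[OF _ abs_ge_self] by (intro AE_I2) (auto simp: mult.assoc)
  qed (rule fm)
  have inner: "(\<integral>t. f t u \<partial>lborel) = indicator {0<..<x} u *\<^sub>R volterra p k u" for u
  proof -
    have "f t u = indicator {0<..<x} u *\<^sub>R (indicator {0<..<u} t *\<^sub>R (p t * k (u - t)))" for t
      by (auto simp: f_def indicator_def)
    then show ?thesis
      by (simp only: volterra_def set_lebesgue_integral_def integral_scaleR_right)
  qed
  have outer: "(\<integral>u. f t u \<partial>lborel) = indicator {0<..<x} t *\<^sub>R (p t * K (x - t) - K 0 * p t)" for t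
  proof -
    have d: "((\<lambda>u. K (u - t)) has_vector_derivative k (u - t)) (at u)" for u
    proof -
      have "((\<lambda>u. u - t) has_vector_derivative 1) (at u)"
        by (auto intro!: derivative_eq_intros)
      from vector_diff_chain_at[OF this K] show ?thesis
        by (simp add: o_def)
    qed
    have "(LINT u:{t<..<x}|lborel. p t * k (u - t)) = p t * (K (x - t) - K (t - t))" if "t \<le> x"
      unfolding set_integral_mult_right
      by (subst integral_Ioo_eq_increment[OF d _ that])
         (auto intro!: continuous_intros continuous_on_compose2[OF k])
    moreover have "(\<integral>u. f t u \<partial>lborel) = indicator {0<..<x} t *\<^sub>R (LINT u:{t<..<x}|lborel. p t * k (u - t))"
      by (simp only: f_def set_lebesgue_integral_def integral_scaleR_right)
    ultimately show ?thesis
      by (auto simp: indicator_def algebra_simps)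
  qed
  show "set_integrable lborel {0<..<x} (volterra p k)"
    using lborel_pair.integrable_snd[OF int] by (simp add: inner set_integrable_def)
  have KI: "set_integrable lborel {0<..<x} (\<lambda>t. p t * K (x - t))"
    by (rule volterra_integrand_integrable[OF pi])
       (use K in \<open>auto simp: continuous_on_eq_continuous_at intro: has_vector_derivative_continuous\<close>)
  have pI: "set_integrable lborel {0<..<x} (\<lambda>t. K 0 * p t)"
    unfolding set_integrable_def by (intro integrable_mult_indicator integrable_mult_right pi) auto
  have "(LINT u:{0<..<x}|lborel. volterra p k u) = (LINT t:{0<..<x}|lborel. p t * K (x - t) - K 0 * p t)"
    using lborel_pair.Fubini_integral[OF int] by (simp add: inner outer set_lebesgue_integral_def)
  also have "\<dots> = volterra p K x - K 0 * (LINT t:{0<..<x}|lborel. p t)"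
    using set_integral_diff(2)[OF KI pI] by (simp add: volterra_def)
  finally show "volterra p K x = K 0 * (LINT t:{0<..<x}|lborel. p t) + (LINT u:{0<..<x}|lborel. volterra p k u)"
    by simp
qed

lemma continuous_on_indefinite_Ioo:
  fixes f :: "real \<Rightarrow> complex"
  assumes "set_integrable lborel {0<..<b} f"
  shows "continuous_on {0..b} (\<lambda>x. LINT u:{0<..<x}|lborel. f u)"
proof -
  have "f integrable_on {0..b}"
    using set_borel_integral_eq_integral(1)[OF assms] by (simp add: integrable_on_Icc_iff_Ioo)
  then have "continuous_on {0..b} (\<lambda>x. integral {0..x} f)"
    by (rule indefinite_integral_continuous_1)
  moreover have "integral {0..x} f = (LINT u:{0<..<x}|lborel. f u)" if "x \<in> {0..b}" for x
  proof -
    have "set_integrable lborel {0<..<x} f"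
      using assms by (rule set_integrable_subset) (use that in auto)
    then show ?thesis
      by (simp add: set_borel_integral_eq_integral(2) integral_open_interval_real)
  qed
  ultimately show ?thesis
    by (metis (no_types, lifting) continuous_on_cong)
qed

lemma continuous_on_volterra:
  fixes K k :: "real \<Rightarrow> complex"
  assumes pi: "integrable lborel p"
    and K: "\<And>x. (K has_vector_derivative k x) (at x)" and k: "continuous_on UNIV k"
  shows "continuous_on {0..b} (volterra p K)"
proof -
  have "set_integrable lborel {0<..<b} p"
    unfolding set_integrable_def by (intro integrable_mult_indicator pi) auto
  then show ?thesis
    unfolding volterra_primitive(2)[OF assms, abs_def] 
    by (intro continuous_intros continuous_on_indefinite_Ioo volterra_primitive(1)[OF pi K k])
qed

lemma has_vector_derivative_indefinite_Ioo:
  fixes f :: "real \<Rightarrow> complex"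
  assumes f: "continuous_on {0..b} f" and x: "x \<in> {0..b}"
  shows "((\<lambda>x. LINT u:{0<..<x}|lborel. f u) has_vector_derivative f x) (at x within {0..b})"
proof -
  have "((\<lambda>x. integral {0..x} f) has_vector_derivative f x) (at x within {0..b})"
    using f x by (rule integral_has_vector_derivative)
  moreover have "integral {0..y} f = (LINT u:{0<..<y}|lborel. f u)" if "y \<in> {0..b}" for y
  proof -
    have "set_integrable lborel {0..y} f"
      by (rule borel_integrable_atLeastAtMost') (use that in \<open>auto intro: continuous_on_subset[OF f]\<close>)
    then have "set_integrable lborel {0<..<y} f"
      by (rule set_integrable_subset) auto
    then show ?thesis
      by (simp add: set_borel_integral_eq_integral(2) integral_open_interval_real)
  qed
  ultimately show ?thesis
    using has_vector_derivative_transform[OF x, of _ "\<lambda>x. integral {0..x} f"] by metis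
qed

section \<open>Zeros of the characteristic function are eigenvalues\<close>

lemma sfun_has_vector_derivative:
  "(sfun \<rho> has_vector_derivative cos (\<rho> * of_real x)) (at x)"
proof (cases "\<rho> = 0")
  case True
  then have "sfun \<rho> = (\<lambda>x. of_real x)"
    by (auto simp: sfun_def fun_eq_iff)
  then show ?thesis
    using True has_vector_derivative_of_real[OF DERIV_ident, of "at x"] by simp
next
  case False
  have "((\<lambda>z. sin (\<rho> * z) / \<rho>) has_field_derivative cos (\<rho> * of_real x)) (at (of_real x))"
    using False by (auto intro!: derivative_eq_intros)
  then have "((\<lambda>x. sin (\<rho> * of_real x) / \<rho>) has_vector_derivative cos (\<rho> * of_real x)) (at x)"
    by (rule has_vector_derivative_real_field)
  then show ?thesis
    using False by (simp add: sfun_def[abs_def])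
qed

lemma cos_has_vector_derivative_sfun:
  "((\<lambda>x. cos (\<rho> * of_real x)) has_vector_derivative - \<rho>\<^sup>2 * sfun \<rho> x) (at x)"
proof -
  have "((\<lambda>z. cos (\<rho> * z)) has_field_derivative - \<rho>\<^sup>2 * sfun \<rho> x) (at (of_real x))"
    by (auto intro!: derivative_eq_intros simp: sfun_def power2_eq_square)
  then show ?thesis
    by (rule has_vector_derivative_real_field)
qed

lemma continuous_on_sfun: "continuous_on UNIV (sfun \<rho>)"
  using sfun_has_vector_derivative
  by (auto simp: continuous_on_eq_continuous_at intro: has_vector_derivative_continuous)

lemma continuous_on_cos_scaled:
  fixes \<rho> :: complex
  shows "continuous_on UNIV (\<lambda>x::real. cos (\<rho> * of_real x))"
  by (intro continuous_intros)

text \<open>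
  The solution with \<open>y 0 = 0\<close>, \<open>y' 0 = c\<close> of the equation in which \<open>y a1 + y a2\<close> is replaced by a
  constant \<open>w\<close> is \<open>c s + w I\<close>.  The rows of the matrix express that its values at \<open>a1\<close> and \<open>a2\<close> are
  numbers \<open>u1\<close>, \<open>u2\<close> with \<open>w = u1 + u2\<close> and that \<open>y \<pi> = 0\<close>, for the vector \<open>(c, u1, u2)\<close>.  A nonzero
  vector in the kernel gives a nonzero \<open>y\<close>, since \<open>y = 0\<close> forces \<open>u1 = u2 = 0\<close> and \<open>c = y' 0 = 0\<close>.
\<close>
lemma eigenvalueI_char_fun_zero:
  assumes a: "0 < a1" "a1 < a2" "a2 < pi"
    and pm: "integrable lborel p" and ae: "AE x in lebesgue_on {0<..<pi}. q x = p x"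
    and z: "char_fun q a1 a2 l = 0"
  shows "eigenvalue q a1 a2 l"
proof -
  define \<rho> where "\<rho> = csqrt l"
  have l: "\<rho>\<^sup>2 = l" by (simp add: \<rho>_def)
  define s where "s = sfun \<rho>"
  define I where "I = volterra p s"
  define C where "C = volterra p (\<lambda>x. cos (\<rho> * of_real x))"
  have pb: "p \<in> borel_measurable borel" using pm by auto
  have I: "Ifun q \<rho> x = I x" if "x \<le> pi" for x
    unfolding I_def s_def by (rule Ifun_eq_volterra[OF pb ae that continuous_on_sfun])
  define M where "M = (vector [vector [s a1, I a1 - 1, I a1],
                   vector [s a2, I a2, I a2 - 1],
                   vector [s pi, I pi, I pi]] :: complex^3^3)"
  have "det M = 0"
    using z a by (simp add: char_fun_def Let_def M_def \<rho>_def[symmetric] I s_def)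
  then have "\<not> invertible M"
    by (simp add: invertible_det_nz)
  then obtain v where v: "M *v v = 0" "v \<noteq> 0"
    using matrix_left_invertible_ker[of M] invertible_left_inverse[of M] by auto
  define c w where "c = v $ 1" and "w = v $ 2 + v $ 3"
  have comp: "(M *v v) $ i = 0" for i using v by simp
  have e1: "c * s a1 + w * I a1 = v $ 2" and e2: "c * s a2 + w * I a2 = v $ 3"
    and e3: "c * s pi + w * I pi = 0"
    using comp[of 1] comp[of 2] comp[of 3]
    by (simp_all add: M_def matrix_vector_mult_def sum_3 vector_3 c_def w_def algebra_simps)
  define y where "y x = c * s x + w * I x" for x
  define y' where "y' x = c * cos (\<rho> * of_real x) + w * C x" for x
  define y'' where "y'' x = w * p x - l * y x" for x
  have wy: "y a1 + y a2 = w"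
    using e1 e2 by (simp add: y_def w_def)
  have s0: "s 0 = 0" by (simp add: s_def sfun_def)
  have I0: "I 0 = 0" "C 0 = 0" by (simp_all add: I_def C_def volterra_def set_lebesgue_integral_def)
  note vp_s = volterra_primitive[OF pm sfun_has_vector_derivative[of \<rho>] continuous_on_cos_scaled]
  have cC: "continuous_on {0..b} C" for b
    unfolding C_def by (rule continuous_on_volterra[OF pm cos_has_vector_derivative_sfun])
       (intro continuous_intros continuous_on_sfun)
  have I_eq: "I = (\<lambda>x. LINT u:{0<..<x}|lborel. C u)"
    using vp_s(2) by (auto simp: I_def s_def C_def sfun_def[of _ 0])
  have dI: "(I has_vector_derivative C x) (at x within {0..pi})" if "x \<in> {0..pi}" for x
    unfolding I_eq by (rule has_vector_derivative_indefinite_Ioo[OF cC that])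
  have dy: "(y has_vector_derivative y' x) (at x within {0..pi})" if "x \<in> {0..pi}" for x
    unfolding y_def y'_def s_def
    by (intro has_vector_derivative_add has_vector_derivative_mult_right dI that
        has_vector_derivative_at_within[OF sfun_has_vector_derivative])
  have cy: "continuous_on {0..pi} y"
    using dy has_vector_derivative_continuous
    unfolding continuous_on_eq_continuous_within by blast
  have iy: "set_integrable lborel {0<..<x} y" if "x \<le> pi" for x
    by (rule set_integrable_subset[OF borel_integrable_atLeastAtMost'[OF cy]]) (use that in auto)
  have ip: "set_integrable lborel {0<..<x} p" for x
    unfolding set_integrable_def by (intro integrable_mult_indicator pm) auto
  have iy'': "set_integrable lborel {0<..<x} y''" if "x \<le> pi" for x
    unfolding y''_def by (intro set_integral_diff set_integrable_mult_right ip iy that)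
  have ii: "(LINT t:{0<..<x}|lebesgue. y'' t) = (LINT t:{0<..<x}|lborel. y'' t)" if "x \<le> pi" for x
    using iy''[OF that] unfolding set_lebesgue_integral_def set_integrable_def 
    by (intro integral_completion) auto
  \<comment> \<open>The cosine kernel starts at 1, so its convolution contributes the term \<open>w p\<close> of \<open>y''\<close>.\<close>
  have "y' x = y' 0 + (LINT t:{0<..<x}|lebesgue. y'' t)" if x: "x \<in> {0..pi}" for x
  proof -
    have ks: "continuous_on UNIV (\<lambda>x. - \<rho>\<^sup>2 * s x)"
      unfolding s_def by (intro continuous_intros continuous_on_sfun)
    note vp_c = volterra_primitive[OF pm cos_has_vector_derivative_sfun[of \<rho>, folded s_def] ks, of x]
    have v: "volterra p (\<lambda>x. - \<rho>\<^sup>2 * s x) = (\<lambda>u. - l * I u)"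
      unfolding volterra_def I_def set_lebesgue_integral_def l[symmetric]
      by (auto simp flip: integral_mult_right_zero simp: algebra_simps fun_eq_iff intro!: Bochner_Integration.integral_cong)
    have iS: "set_integrable lborel {0<..<x} (\<lambda>x. - \<rho>\<^sup>2 * s x)"
      by (rule set_integrable_subset[OF borel_integrable_atLeastAtMost'[OF continuous_on_subset[OF ks], of 0 x]]) auto
    have iI: "set_integrable lborel {0<..<x} (\<lambda>u. - l * I u)"
      using vp_c(1) unfolding v .
    have Cx: "C x = (LINT t:{0<..<x}|lborel. p t) + (LINT u:{0<..<x}|lborel. - l * I u)"
      using vp_c(2) unfolding v C_def by simp
    have cx: "cos (\<rho> * of_real x) = 1 + (LINT u:{0<..<x}|lborel. - \<rho>\<^sup>2 * s u)"
      using integral_Ioo_eq_increment[OF cos_has_vector_derivative_sfun[of \<rho>, folded s_def] ks, of 0 x] x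
      by simp
    have i1: "set_integrable lborel {0<..<x} (\<lambda>u. c * (- \<rho>\<^sup>2 * s u))"
      and i2: "set_integrable lborel {0<..<x} (\<lambda>u. w * p u)"
      and i3: "set_integrable lborel {0<..<x} (\<lambda>u. w * (- l * I u))"
      by (rule set_integrable_mult_right, rule iS ip iI)+
    have "y' x = c + (c * (LINT u:{0<..<x}|lborel. - \<rho>\<^sup>2 * s u) +
        (w * (LINT t:{0<..<x}|lborel. p t) + w * (LINT u:{0<..<x}|lborel. - l * I u)))"
      by (simp only: y'_def Cx cx ring_distribs mult_1_right add.assoc)
    also have "c * (LINT u:{0<..<x}|lborel. - \<rho>\<^sup>2 * s u) +
        (w * (LINT t:{0<..<x}|lborel. p t) + w * (LINT u:{0<..<x}|lborel. - l * I u)) =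
        (LINT u:{0<..<x}|lborel. c * (- \<rho>\<^sup>2 * s u) + (w * p u + w * (- l * I u)))"
      by (simp only: set_integral_add(2)[OF i1 set_integral_add(1)[OF i2 i3]]
          set_integral_add(2)[OF i2 i3] set_integral_mult_right)
    also have "(\<lambda>u. c * (- \<rho>\<^sup>2 * s u) + (w * p u + w * (- l * I u))) = y''"
      by (auto simp: y''_def y_def l algebra_simps)
    also have "(LINT u:{0<..<x}|lborel. y'' u) = (LINT u:{0<..<x}|lebesgue. y'' u)"
      using ii x by simp
    finally show ?thesis
      by (simp add: y'_def I0)
  qed
  moreover have "set_integrable lebesgue {0<..<pi} y''"
    using iy''[of pi] unfolding set_integrable_def
    by (subst integrable_completion) auto
  moreover have "AE x in lebesgue_on {0<..<pi}. - y'' x + q x * (y a1 + y a2) = l * y x"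
    using ae by eventually_elim (simp add: y''_def wy)
  moreover have "y 0 = 0" "y pi = 0"
    using e3 by (simp_all add: y_def s0 I0)
  ultimately have "bvp_solution q a1 a2 l y"
    unfolding bvp_solution_def using dy by blast
  moreover have "\<exists>x\<in>{0..pi}. y x \<noteq> 0"
  proof (rule ccontr)
    assume "\<not> ?thesis"
    then have y0: "y x = 0" if "x \<in> {0..pi}" for x using that by blast
    have "v $ 2 = 0" "v $ 3 = 0"
      using y0[of a1] y0[of a2] a e1 e2 by (simp_all add: y_def)
    moreover have "y' 0 = 0"
    proof -
      have "(y has_vector_derivative 0) (at 0 within {0..pi})"
        by (rule has_vector_derivative_transform[of _ _ _ "\<lambda>_. 0"]) (use y0 in auto)
      then show ?thesis
        using dy[of 0] vector_derivative_unique_within[of 0 "{0..pi}"] by (auto simp: trivial_limit_within)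
    qed
    then have "c = 0" by (simp add: y'_def I0)
    ultimately have "v = 0" by (simp add: vec_eq_iff forall_3 c_def)
    then show False using v by simp
  qed
  ultimately show ?thesis
    unfolding eigenvalue_def by blast
qed

section \<open>Expansion and growth of the characteristic function\<close>

lemma sfun_minus [simp]: "sfun (- \<rho>) x = sfun \<rho> x"
  by (simp add: sfun_def)

lemma sfun_csqrt_power2: "sfun (csqrt (\<rho>\<^sup>2)) = sfun \<rho>"
proof -
  have "(csqrt (\<rho>\<^sup>2))\<^sup>2 = \<rho>\<^sup>2" by simp
  then have "csqrt (\<rho>\<^sup>2) = \<rho> \<or> csqrt (\<rho>\<^sup>2) = - \<rho>"
    by (metis power2_eq_iff)
  then show ?thesis by (auto simp: fun_eq_iff)
qed

text \<open>
  The summand of the expanded determinant that belongs to one of the points \<open>a1\<close>, \<open>a2\<close>.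
\<close>
definition interaction :: "(real \<Rightarrow> complex) \<Rightarrow> complex \<Rightarrow> real \<Rightarrow> complex" where
  "interaction p \<rho> a = sfun \<rho> a * volterra p (sfun \<rho>) pi - sfun \<rho> pi * volterra p (sfun \<rho>) a"

lemma char_fun_eq_interactions:
  assumes a: "a1 \<le> pi" "a2 \<le> pi"
    and p: "p \<in> borel_measurable borel" "AE x in lebesgue_on {0<..<pi}. q x = p x"
  shows "char_fun q a1 a2 (\<rho>\<^sup>2) = sfun \<rho> pi + interaction p \<rho> a1 + interaction p \<rho> a2"
proof -
  have "Ifun q (csqrt (\<rho>\<^sup>2)) x = volterra p (sfun \<rho>) x" if "x \<le> pi" for x
    using Ifun_eq_volterra[OF p that continuous_on_sfun] by (simp add: sfun_csqrt_power2)
  then show ?thesis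
    using a by (simp add: char_fun_def Let_def sfun_csqrt_power2 det_3 vector_3 interaction_def
        algebra_simps)
qed

lemma cmod_sin_le_exp: "cmod (sin z) \<le> exp \<bar>Im z\<bar>"
proof -
  have "cmod (sin z) = cmod (exp (\<i> * z) - exp (- (\<i> * z))) / 2"
    by (simp add: sin_exp_eq norm_divide norm_mult)
  also have "\<dots> \<le> (cmod (exp (\<i> * z)) + cmod (exp (- (\<i> * z)))) / 2"
    by (intro divide_right_mono norm_triangle_ineq4) auto
  also have "\<dots> \<le> (exp \<bar>Im z\<bar> + exp \<bar>Im z\<bar>) / 2"
    by (intro divide_right_mono add_mono) auto
  finally show ?thesis by simp
qed

lemma cmod_sin_scaled_le:
  assumes "0 \<le> x"
  shows "cmod (sin (\<rho> * of_real x)) \<le> exp (\<bar>Im \<rho>\<bar> * x)"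
  using cmod_sin_le_exp[of "\<rho> * of_real x"] assms by (simp add: abs_mult)

lemma sin_product_cancellation:
  fixes a b t r :: complex
  shows "sin (r * a) * sin (r * (b - t)) - sin (r * b) * sin (r * (a - t)) = sin (r * (b - a)) * sin (r * t)"
proof -
  have 1: "r * (b - t) = r * b - r * t" "r * (a - t) = r * a - r * t" "r * (b - a) = r * b - r * a"
    by (simp_all add: algebra_simps)
  show ?thesis
    unfolding 1 sin_diff by (simp add: algebra_simps)
qed

text \<open>
  Write the interaction as one integral over \<open>t\<close>.  Its integrand vanishes outside \<open>(0, \<pi>)\<close>, is a
  multiple of \<open>sin (\<rho> (\<pi> - a)) sin (\<rho> t)\<close> for \<open>t < a\<close> by \<open>sin_product_cancellation\<close>, and of
  \<open>sin (\<rho> a) sin (\<rho> (\<pi> - t))\<close> for \<open>t \<ge> a\<close>.  In both cases the two arguments, divided by \<open>\<rho>\<close>, are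
  nonnegative and add up to at most \<open>\<pi>\<close>.
\<close>
lemma interaction_bound:
  assumes a: "0 \<le> a" "a \<le> pi" and p: "integrable lborel p" and \<rho>: "\<rho> \<noteq> 0"
  shows "cmod (interaction p \<rho> a) \<le> (\<integral>t. norm (p t) \<partial>lborel) * (exp (pi * \<bar>Im \<rho>\<bar>) / (cmod \<rho>)\<^sup>2)"
proof -
  define E where "E = exp (pi * \<bar>Im \<rho>\<bar>) / (cmod \<rho>)\<^sup>2"
  define g where "g t = sfun \<rho> a * (indicator {0<..<pi} t *\<^sub>R (p t * sfun \<rho> (pi - t))) -
    sfun \<rho> pi * (indicator {0<..<a} t *\<^sub>R (p t * sfun \<rho> (a - t)))" for t
  have int: "integrable lborel (\<lambda>t. indicator {0<..<x} t *\<^sub>R (p t * sfun \<rho> (x - t)))" for x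
    using volterra_integrand_integrable[OF p continuous_on_sfun] by (simp add: set_integrable_def)
  have "interaction p \<rho> a = (\<integral>t. g t \<partial>lborel)"
    unfolding interaction_def volterra_def set_lebesgue_integral_def g_def
    by (simp only: Bochner_Integration.integral_diff integrable_mult_right int integral_mult_right_zero)
  also have "cmod \<dots> \<le> (\<integral>t. norm (g t) \<partial>lborel)"
    by (rule integral_norm_bound)
  also have "\<dots> \<le> (\<integral>t. norm (p t) * E \<partial>lborel)"
  proof (rule integral_mono)
    show "integrable lborel (\<lambda>t. norm (g t))"
      unfolding g_def by (intro integrable_norm Bochner_Integration.integrable_diff integrable_mult_right int)
    show "integrable lborel (\<lambda>t. norm (p t) * E)"
      using p by simp
  next
    fix t
    have prod: "cmod (sin (\<rho> * of_real x) * sin (\<rho> * of_real y)) / (cmod \<rho>)\<^sup>2 \<le> E"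
      if "0 \<le> x" "0 \<le> y" "x + y \<le> pi" for x y
    proof -
      have "cmod (sin (\<rho> * of_real x) * sin (\<rho> * of_real y)) \<le> exp (\<bar>Im \<rho>\<bar> * x) * exp (\<bar>Im \<rho>\<bar> * y)"
        unfolding norm_mult by (intro mult_mono cmod_sin_scaled_le that) auto
      also have "\<dots> = exp ((x + y) * \<bar>Im \<rho>\<bar>)"
        by (simp add: exp_add[symmetric] algebra_simps)
      also have "\<dots> \<le> exp (pi * \<bar>Im \<rho>\<bar>)"
        using that by (simp add: mult_right_mono)
      finally show ?thesis
        by (simp add: E_def divide_right_mono)
    qed
    consider "t \<le> 0 \<or> pi \<le> t" | "0 < t" "t < a" | "0 < t" "a \<le> t" "t < pi" by linarith
    then show "norm (g t) \<le> norm (p t) * E"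
    proof cases
      case 1
      then have "g t = 0" using a by (auto simp: g_def indicator_def)
      then show ?thesis by (simp add: E_def)
    next
      case 2
      have "g t = p t * (sin (\<rho> * of_real (pi - a)) * sin (\<rho> * of_real t) / \<rho>\<^sup>2)"
        using 2 a \<rho> sin_product_cancellation[of \<rho> "of_real a" "of_real pi" "of_real t"]
        by (simp add: g_def indicator_def sfun_def field_simps power2_eq_square)
      also have "norm \<dots> = norm (p t) * (cmod (sin (\<rho> * of_real (pi - a)) * sin (\<rho> * of_real t)) / (cmod \<rho>)\<^sup>2)"
        by (simp add: norm_mult norm_divide norm_power)
      also have "\<dots> \<le> norm (p t) * E"
        using 2 a by (intro mult_left_mono prod) auto
      finally show ?thesis .
    next
      case 3
      have "g t = p t * (sin (\<rho> * of_real a) * sin (\<rho> * of_real (pi - t)) / \<rho>\<^sup>2)"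
        using 3 a \<rho> by (simp add: g_def indicator_def sfun_def field_simps power2_eq_square)
      also have "norm \<dots> = norm (p t) * (cmod (sin (\<rho> * of_real a) * sin (\<rho> * of_real (pi - t))) / (cmod \<rho>)\<^sup>2)"
        by (simp add: norm_mult norm_divide norm_power)
      also have "\<dots> \<le> norm (p t) * E"
        using 3 a by (intro mult_left_mono prod) auto
      finally show ?thesis .
    qed
  qed
  finally show ?thesis by (simp add: E_def)
qed

section \<open>Analyticity in the spectral parameter\<close>

text \<open>
  Only powers of \<open>\<rho>\<^sup>2\<close> occur, so that evaluating at \<open>\<rho> = csqrt l\<close> gives a power series in \<open>l\<close> and the
  branch cut of the square root disappears.
\<close>
lemma sfun_sums:
  "(\<lambda>n. (-1) ^ n * of_real x ^ (2 * n + 1) / fact (2 * n + 1) * (\<rho>\<^sup>2) ^ n) sums sfun \<rho> x"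
proof (cases "\<rho> = 0")
  case True
  have "(\<lambda>n. (-1) ^ n * of_real x ^ (2 * n + 1) / fact (2 * n + 1) * (0::complex) ^ n) sums of_real x"
    using sums_If_finite_set[of "{0}" "\<lambda>n. (-1) ^ n * of_real x ^ (2 * n + 1) / fact (2 * n + 1) * (0::complex) ^ n"]
    by (auto simp: sums_def power_0_left if_distrib cong: if_cong)
  then show ?thesis using True by (simp add: sfun_def)
next
  case False
  let ?z = "\<rho> * of_real x"
  have "strict_mono (\<lambda>n::nat. 2 * n + 1)"
    by (auto simp: strict_mono_def)
  moreover have "sin_coeff n *\<^sub>R ?z ^ n = 0" if "n \<notin> range (\<lambda>n. 2 * n + 1)" for n
    using that by (auto simp: sin_coeff_def elim!: oddE)
  ultimately have "(\<lambda>n. sin_coeff (2 * n + 1) *\<^sub>R ?z ^ (2 * n + 1)) sums sin ?z"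
    using sin_converges[of ?z]
      sums_mono_reindex[of "\<lambda>n. 2 * n + 1" "\<lambda>n. sin_coeff n *\<^sub>R ?z ^ n" "sin ?z"] by blast
  then have "(\<lambda>n. sin_coeff (2 * n + 1) *\<^sub>R ?z ^ (2 * n + 1) / \<rho>) sums (sin ?z / \<rho>)"
    by (rule sums_divide)
  also have "(\<lambda>n. sin_coeff (2 * n + 1) *\<^sub>R ?z ^ (2 * n + 1) / \<rho>) =
      (\<lambda>n. (-1) ^ n * of_real x ^ (2 * n + 1) / fact (2 * n + 1) * (\<rho>\<^sup>2) ^ n)"
    using False by (auto simp: sin_coeff_def scaleR_conv_of_real power_mult_distrib power_mult[symmetric] field_simps simp del: fact_Suc)
  finally show ?thesis
    using False by (simp add: sfun_def)
qed

lemma everywhere_convergent_power_series_holomorphic: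
  fixes f :: "complex \<Rightarrow> complex"
  assumes "\<And>z. (\<lambda>n. a n * z ^ n) sums f z"
  shows "f holomorphic_on UNIV"
proof -
  have "f field_differentiable at z" for z
  proof -
    have "f holomorphic_on ball 0 (cmod z + 1)"
      by (rule power_series_holomorphic[where a = a]) (use assms in simp)
    then show ?thesis
      by (rule holomorphic_on_imp_differentiable_at) auto
  qed
  then show ?thesis
    by (simp add: holomorphic_on_def)
qed

lemma sfun_holomorphic: "(\<lambda>l. sfun (csqrt l) x) holomorphic_on UNIV"
  by (rule everywhere_convergent_power_series_holomorphic[where
        a = "\<lambda>n. (-1) ^ n * of_real x ^ (2 * n + 1) / fact (2 * n + 1)"])
     (use sfun_sums[of x "csqrt l" for l] in simp)

text \<open>
  Convolving the series of \<open>sfun_sums\<close> term by term gives a power series in \<open>l\<close> again; the interchange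
  is justified by the integrable majorants \<open>\<bar>p t\<bar> B n\<close>.
\<close>
lemma volterra_sfun_holomorphic:
  assumes p: "integrable lborel p"
  shows "(\<lambda>l. volterra p (sfun (csqrt l)) x) holomorphic_on UNIV"
proof -
  define c :: "nat \<Rightarrow> real \<Rightarrow> complex" where "c n t = (-1) ^ n * of_real (x - t) ^ (2 * n + 1) / fact (2 * n + 1)" for n and t
  define A where "A n = (\<integral>t. indicator {0<..<x} t *\<^sub>R (p t * c n t) \<partial>lborel)" for n
  have "(\<lambda>n. A n * l ^ n) sums volterra p (sfun (csqrt l)) x" for l
  proof -
    define f where "f n t = indicator {0<..<x} t *\<^sub>R (p t * (c n t * l ^ n))" for n t
    \<comment> \<open>Weakening \<open>(2 n + 1)!\<close> to \<open>n!\<close> makes the majorant an exponential series.\<close>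
    define B where "B n = \<bar>x\<bar> * ((x\<^sup>2 * cmod l) ^ n / fact n)" for n :: nat
    have bd: "norm (f n t) \<le> norm (p t) * B n" for n t
    proof (cases "0 < t \<and> t < x")
      case True
      have "cmod (c n t) = (x - t) ^ (2 * n + 1) / fact (2 * n + 1)"
        using True by (simp add: c_def norm_mult norm_divide norm_power del: of_real_diff fact_Suc power_Suc)
      also have "\<dots> \<le> x ^ (2 * n + 1) / fact n"
        using True by (intro frac_le power_mono fact_mono) auto
      finally have "cmod (c n t) * cmod l ^ n \<le> x ^ (2 * n + 1) / fact n * cmod l ^ n"
        by (intro mult_right_mono) auto
      also have "\<dots> = B n"
        using True by (simp add: B_def power_mult_distrib power_mult)
      finally show ?thesis
        using True by (simp add: f_def norm_mult norm_power mult_left_mono)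
    next
      case False
      then show ?thesis by (auto simp: f_def B_def)
    qed
    have sB: "summable B"
      unfolding B_def using summable_mult[OF summable_exp[of "x\<^sup>2 * cmod l"], of "\<bar>x\<bar>"]
      by (simp add: field_simps)
    have fi: "integrable lborel (f n)" for n
      using volterra_integrand_integrable[OF p,
          of "\<lambda>y. (-1) ^ n * of_real y ^ (2 * n + 1) / fact (2 * n + 1) * l ^ n" x]
      by (simp add: set_integrable_def f_def[abs_def] c_def continuous_intros
          del: of_real_diff fact_Suc power_Suc)
    have sums: "(\<lambda>n. f n t) sums (indicator {0<..<x} t *\<^sub>R (p t * sfun (csqrt l) (x - t)))" for t
      unfolding f_def c_def
      by (intro sums_scaleR_right sums_mult) (use sfun_sums[of "x - t" "csqrt l"] in simp)
    have "(\<lambda>n. integral\<^sup>L lborel (f n)) sums (\<integral>t. (\<Sum>n. f n t) \<partial>lborel)"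
    proof (rule sums_integral[OF fi])
      show "AE t in lborel. summable (\<lambda>n. norm (f n t))"
        using bd by (intro AE_I2 summable_comparison_test'[OF summable_mult[OF sB]]) auto
      show "summable (\<lambda>n. \<integral>t. norm (f n t) \<partial>lborel)"
      proof (rule summable_comparison_test'[OF summable_mult[OF sB]])
        fix n :: nat
        have "(\<integral>t. norm (f n t) \<partial>lborel) \<le> (\<integral>t. norm (p t) * B n \<partial>lborel)"
          using bd p fi by (intro integral_mono) auto
        then show "norm (\<integral>t. norm (f n t) \<partial>lborel) \<le> (\<integral>t. norm (p t) \<partial>lborel) * B n"
          by simp
      qed
    qed
    moreover have "integral\<^sup>L lborel (f n) = A n * l ^ n" for n
    proof -
      have "f n = (\<lambda>t. (indicator {0<..<x} t *\<^sub>R (p t * c n t)) * l ^ n)"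
        by (auto simp: f_def fun_eq_iff)
      then show ?thesis
        by (simp only: A_def integral_mult_left_zero)
    qed
    moreover have "(\<integral>t. (\<Sum>n. f n t) \<partial>lborel) = volterra p (sfun (csqrt l)) x"
      using sums by (simp add: sums_iff volterra_def set_lebesgue_integral_def)
    ultimately show ?thesis by simp
  qed
  then show ?thesis
    by (rule everywhere_convergent_power_series_holomorphic)
qed

lemma char_fun_holomorphic:
  assumes a: "a1 \<le> pi" "a2 \<le> pi"
    and p: "integrable lborel p" "AE x in lebesgue_on {0<..<pi}. q x = p x"
  shows "char_fun q a1 a2 holomorphic_on UNIV"
proof -
  have "char_fun q a1 a2 = (\<lambda>l. sfun (csqrt l) pi + interaction p (csqrt l) a1 + interaction p (csqrt l) a2)"
    using char_fun_eq_interactions[OF a _ p(2), of "csqrt l" for l] p(1) by auto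
  then show ?thesis
    unfolding interaction_def
    by (simp only:) (intro holomorphic_intros sfun_holomorphic volterra_sfun_holomorphic p)
qed

section \<open>An entire function determined by its zeros and its asymptotics\<close>

lemma cmod_sin_ge_of_abs_Im_ge_1:
  assumes "1 \<le> \<bar>Im z\<bar>"
  shows "exp \<bar>Im z\<bar> / 4 \<le> cmod (sin z)"
proof -
  let ?u = "exp (\<i> * z)" and ?v = "exp (- (\<i> * z))"
  have "2 \<le> exp (2 * \<bar>Im z\<bar>)"
    using exp_ge_add_one_self[of "2 * \<bar>Im z\<bar>"] assms by linarith
  then have "2 * exp (- \<bar>Im z\<bar>) \<le> exp (2 * \<bar>Im z\<bar>) * exp (- \<bar>Im z\<bar>)"
    by (rule mult_right_mono) simp
  then have "exp \<bar>Im z\<bar> / 4 \<le> (exp \<bar>Im z\<bar> - exp (- \<bar>Im z\<bar>)) / 2"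
    by (simp add: exp_add[symmetric])
  also have "\<dots> = \<bar>cmod ?u - cmod ?v\<bar> / 2"
    by (simp add: abs_if)
  also have "\<dots> \<le> cmod (?u - ?v) / 2"
    by (intro divide_right_mono norm_triangle_ineq3) auto
  also have "\<dots> = cmod (sin z)"
    by (simp add: sin_exp_eq norm_divide norm_mult)
  finally show ?thesis .
qed

text \<open>
  On these vertical lines \<open>sin (\<pi> Re \<rho>) = \<plusminus> 1\<close>, and already the real part of \<open>sin (\<pi> \<rho>)\<close>, which is
  \<open>sin (\<pi> Re \<rho>) cosh (\<pi> Im \<rho>)\<close>, is large enough.
\<close>
lemma cmod_sin_pi_ge_half_integer:
  assumes "\<bar>Re \<rho>\<bar> = real N + 1 / 2"
  shows "exp (pi * \<bar>Im \<rho>\<bar>) / 4 \<le> cmod (sin (\<rho> * of_real pi))"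
proof -
  have "pi * \<bar>Re \<rho>\<bar> = pi * real (Suc (2 * N)) / 2"
    using assms by (simp add: field_simps)
  then have "cos (pi * \<bar>Re \<rho>\<bar>) = 0"
    by (simp only: cos_pi_eq_zero)
  moreover have "cos (pi * \<bar>Re \<rho>\<bar>) = cos (Re \<rho> * pi)"
    by (simp add: abs_if mult.commute)
  ultimately have s: "\<bar>sin (Re \<rho> * pi)\<bar> = 1"
    using sin_cos_squared_add[of "Re \<rho> * pi"] by (simp add: power2_eq_1_iff) (auto)
  have "exp (pi * \<bar>Im \<rho>\<bar>) / 4 \<le> (exp (Im \<rho> * pi) + exp (- (Im \<rho> * pi))) / 2"
    by (cases "0 \<le> Im \<rho>") (auto simp: abs_if mult.commute intro: add_increasing add_increasing2)
  also have "\<dots> = \<bar>Re (sin (\<rho> * of_real pi))\<bar>"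
    using s by (simp add: Re_sin abs_mult)
  also have "\<dots> \<le> cmod (sin (\<rho> * of_real pi))"
    by (rule abs_Re_le_cmod)
  finally show ?thesis .
qed

lemma cmod_sin_pi_ge_on_square:
  assumes "\<bar>Re \<rho>\<bar> = real N + 1 / 2 \<or> \<bar>Im \<rho>\<bar> = real N + 1 / 2"
  shows "exp (pi * \<bar>Im \<rho>\<bar>) / 4 \<le> cmod (sin (\<rho> * of_real pi))"
proof (cases "\<bar>Re \<rho>\<bar> = real N + 1 / 2")
  case True
  then show ?thesis by (rule cmod_sin_pi_ge_half_integer)
next
  case False
  then have "1 / 2 \<le> \<bar>Im \<rho>\<bar>" using assms by linarith
  then have "3 * (1 / 2) \<le> pi * \<bar>Im \<rho>\<bar>"
    using pi_gt3 by (intro mult_mono) auto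
  then show ?thesis
    using cmod_sin_ge_of_abs_Im_ge_1[of "\<rho> * of_real pi"] by (simp add: abs_mult mult.commute)
qed

lemma entire_frequently_nonzero:
  assumes f: "f holomorphic_on UNIV" and w: "f w \<noteq> 0"
  shows "frequently (\<lambda>x. f x \<noteq> 0) (at (z::complex))"
proof (rule ccontr)
  assume "\<not> ?thesis"
  then have "eventually (\<lambda>x. x \<in> {x. f x = 0}) (at z)"
    by (simp add: not_frequently)
  then have "z islimpt {x. f x = 0}"
    by (simp add: islimpt_conv_frequently_at eventually_frequently)
  from analytic_continuation[OF f open_UNIV connected_UNIV subset_UNIV UNIV_I this _ UNIV_I]
  have "f w = 0" by simp
  then show False using w by simp
qed

text \<open>
  The order of \<open>f / g\<close> is nonnegative everywhere, hence it has no poles and its singularities are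
  removable.  The nonvanishing points \<open>u\<close> and \<open>v\<close> exclude the zero function, for which \<open>zorder\<close> has no
  meaning.
\<close>
lemma entire_quotient:
  fixes f g :: "complex \<Rightarrow> complex"
  assumes f: "f holomorphic_on UNIV" "f u \<noteq> 0" and g: "g holomorphic_on UNIV" "g v \<noteq> 0"
    and z: "\<And>z. zorder g z \<le> zorder f z"
  obtains h where "h holomorphic_on UNIV" "\<And>z. g z \<noteq> 0 \<Longrightarrow> h z = f z / g z"
proof -
  define h where "h = remove_sings (\<lambda>z. f z / g z)"
  have fa: "f analytic_on {z}" and ga: "g analytic_on {z}" for z
    using f(1) g(1) by (auto simp: analytic_on_open[symmetric] intro: analytic_on_subset)
  have m: "(\<lambda>z. f z / g z) meromorphic_on {z}" for z
    by (intro meromorphic_intros analytic_on_imp_meromorphic_on fa ga)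
  have "h analytic_on {z}" for z
  proof -
    have "zorder (\<lambda>z. f z / g z) z \<ge> 0"
      using z[of z] by (subst zorder_divide)
        (auto intro!: analytic_on_imp_meromorphic_on fa ga entire_frequently_nonzero[OF f]
          entire_frequently_nonzero[OF g])
    moreover have iso: "isolated_singularity_at (\<lambda>z. f z / g z) z" and "not_essential (\<lambda>z. f z / g z) z"
      using m[of z] by (auto simp: meromorphic_at_iff)
    ultimately obtain c where "(\<lambda>z. f z / g z) \<midarrow>z\<rightarrow> c"
      using isolated_pole_imp_neg_zorder[OF iso] unfolding not_essential_def by fastforce
    with iso show ?thesis
      unfolding h_def by (rule remove_sings_analytic_at)
  qed
  then have "h holomorphic_on UNIV"
    by (metis analytic_imp_holomorphic analytic_on_analytic_at)
  moreover have "h z = f z / g z" if "g z \<noteq> 0" for z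
    unfolding h_def by (intro remove_sings_at_analytic analytic_intros fa ga) (use that in auto)
  ultimately show ?thesis using that by blast
qed

text \<open>
  With \<open>h = f / g\<close> entire, \<open>h (\<rho>\<^sup>2) - 1\<close> is at most \<open>16 M / N\<close> on the boundary of the square of half
  side \<open>N + 1/2\<close>, hence inside it; letting \<open>N\<close> grow gives \<open>h = 1\<close>.  Working in the \<open>\<rho>\<close>-plane makes
  these squares available.  The condition on the orders is required only when neither function is
  identically zero; that this is the case follows from the asymptotics.
\<close>
lemma entire_eq_by_zeros_and_asymptotics:
  fixes f g :: "complex \<Rightarrow> complex"
  assumes f: "f holomorphic_on UNIV" and g: "g holomorphic_on UNIV"
    and fa: "\<And>\<rho>. \<rho> \<noteq> 0 \<Longrightarrow> cmod (f (\<rho>\<^sup>2) - sfun \<rho> pi) \<le> M * (exp (pi * \<bar>Im \<rho>\<bar>) / (cmod \<rho>)\<^sup>2)"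
    and ga: "\<And>\<rho>. \<rho> \<noteq> 0 \<Longrightarrow> cmod (g (\<rho>\<^sup>2) - sfun \<rho> pi) \<le> M * (exp (pi * \<bar>Im \<rho>\<bar>) / (cmod \<rho>)\<^sup>2)"
    and z: "(\<exists>u. f u \<noteq> 0) \<Longrightarrow> (\<exists>v. g v \<noteq> 0) \<Longrightarrow> (\<And>z. zorder g z \<le> zorder f z)"
  shows "f z = g z"
proof -
  define R where "R N = real N + 1 / 2" for N
  \<comment> \<open>For \<open>N \<ge> 8 M\<close> the error term is at most half of the lower bound for the sine.\<close>
  have lower: "cmod \<rho> * cmod (F (\<rho>\<^sup>2)) \<ge> exp (pi * \<bar>Im \<rho>\<bar>) / 8"
    if F: "\<And>\<rho>. \<rho> \<noteq> 0 \<Longrightarrow> cmod (F (\<rho>\<^sup>2) - sfun \<rho> pi) \<le> M * (exp (pi * \<bar>Im \<rho>\<bar>) / (cmod \<rho>)\<^sup>2)"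
    and \<rho>: "\<bar>Re \<rho>\<bar> = R N \<or> \<bar>Im \<rho>\<bar> = R N" and N: "8 * M \<le> real N" for F \<rho> N
  proof -
    let ?E = "exp (pi * \<bar>Im \<rho>\<bar>)"
    have N0: "R N \<le> cmod \<rho>"
      using \<rho> abs_Re_le_cmod[of \<rho>] abs_Im_le_cmod[of \<rho>] by auto
    then have pos: "0 < cmod \<rho>" by (smt (verit) R_def of_nat_0_le_iff half_gt_zero_iff)
    have "M * ?E / cmod \<rho> \<le> ?E / 8"
      using N0 N pos by (simp add: R_def field_simps)
    moreover have "cmod \<rho> * cmod (F (\<rho>\<^sup>2) - sfun \<rho> pi) \<le> cmod \<rho> * (M * (?E / (cmod \<rho>)\<^sup>2))"
      using pos by (intro mult_left_mono F) auto
    moreover have "cmod \<rho> * (M * (?E / (cmod \<rho>)\<^sup>2)) = M * ?E / cmod \<rho>"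
      using pos by (simp add: power2_eq_square)
    moreover have "?E / 4 \<le> cmod \<rho> * cmod (sfun \<rho> pi)"
      using cmod_sin_pi_ge_on_square[of \<rho> N] \<rho> pos by (simp add: sfun_def R_def norm_divide)
    moreover have "cmod \<rho> * cmod (sfun \<rho> pi) \<le> cmod \<rho> * (cmod (F (\<rho>\<^sup>2)) + cmod (F (\<rho>\<^sup>2) - sfun \<rho> pi))"
      by (intro mult_left_mono) (auto simp: norm_minus_commute intro: norm_triangle_sub)
    ultimately show ?thesis unfolding distrib_left by linarith
  qed
  have nz: "\<exists>u. F u \<noteq> 0"
    if F: "\<And>\<rho>. \<rho> \<noteq> 0 \<Longrightarrow> cmod (F (\<rho>\<^sup>2) - sfun \<rho> pi) \<le> M * (exp (pi * \<bar>Im \<rho>\<bar>) / (cmod \<rho>)\<^sup>2)" for F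
  proof -
    obtain N where N: "8 * M \<le> real N" using real_arch_simple by blast
    have "exp (pi * \<bar>Im (of_real (R N))\<bar>) / 8 \<le> cmod (of_real (R N)) * cmod (F ((of_real (R N))\<^sup>2))"
      by (rule lower[OF F _ N]) (auto simp: R_def)
    moreover have "0 < exp (pi * \<bar>Im (of_real (R N))\<bar>) / 8" by simp
    ultimately have "F ((of_real (R N))\<^sup>2) \<noteq> 0" by auto
    then show ?thesis by blast
  qed
  note zo = z[OF nz[OF fa] nz[OF ga]]
  obtain u v where uv: "f u \<noteq> 0" "g v \<noteq> 0" using nz[OF fa] nz[OF ga] by blast
  obtain h where h: "h holomorphic_on UNIV" and hq: "\<And>z. g z \<noteq> 0 \<Longrightarrow> h z = f z / g z"
    using entire_quotient[OF f uv(1) g uv(2) zo] by blast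
  define H where "H \<rho> = h (\<rho>\<^sup>2) - 1" for \<rho>
  have Hh: "H holomorphic_on S" for S
    unfolding H_def
    by (intro holomorphic_intros holomorphic_on_compose_gen[OF _ h, unfolded o_def]) auto
  have small: "cmod (H \<rho>) \<le> 16 * M / real N"
    if N: "8 * M \<le> real N" "0 < N" "cmod \<rho> \<le> real N" for \<rho> N
  proof -
    let ?S = "cbox (Complex (- R N) (- R N)) (Complex (R N) (R N))"
    show ?thesis
    proof (rule maximum_modulus_frontier[where S = ?S and f = H])
      show "H holomorphic_on interior ?S" "continuous_on (closure ?S) H"
        by (auto intro: Hh holomorphic_on_imp_continuous_on)
      show "\<rho> \<in> ?S"
        using N(3) abs_Re_le_cmod[of \<rho>] abs_Im_le_cmod[of \<rho>]
        by (auto simp: in_cbox_complex_iff R_def)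
    next
      fix \<zeta> assume "\<zeta> \<in> frontier ?S"
      then have \<zeta>: "\<bar>Re \<zeta>\<bar> = R N \<or> \<bar>Im \<zeta>\<bar> = R N"
        by (auto simp: frontier_cbox in_cbox_complex_iff in_box_complex_iff)
      let ?E = "exp (pi * \<bar>Im \<zeta>\<bar>)"
      have N0: "real N \<le> cmod \<zeta>"
        using \<zeta> abs_Re_le_cmod[of \<zeta>] abs_Im_le_cmod[of \<zeta>] by (auto simp: R_def)
      then have pos: "0 < cmod \<zeta>" using N by linarith
      then have z0: "\<zeta> \<noteq> 0" by auto
      have M0: "0 \<le> M"
        using order_trans[OF norm_ge_zero fa[OF z0]] pos by (simp add: zero_le_mult_iff zero_le_divide_iff)
      have low: "?E / 8 \<le> cmod \<zeta> * cmod (g (\<zeta>\<^sup>2))"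
        by (rule lower[OF ga \<zeta> N(1)])
      moreover have "0 < ?E / 8" by simp
      ultimately have g0: "g (\<zeta>\<^sup>2) \<noteq> 0" by auto
      have "cmod (f (\<zeta>\<^sup>2) - g (\<zeta>\<^sup>2)) \<le> 2 * M * (?E / (cmod \<zeta>)\<^sup>2)"
        using norm_triangle_ineq4[of "f (\<zeta>\<^sup>2) - sfun \<zeta> pi" "g (\<zeta>\<^sup>2) - sfun \<zeta> pi"] fa[OF z0] ga[OF z0]
        by simp
      also have "\<dots> = 16 * M / (cmod \<zeta>)\<^sup>2 * (?E / 8)" by simp
      also have "\<dots> \<le> 16 * M / (cmod \<zeta>)\<^sup>2 * (cmod \<zeta> * cmod (g (\<zeta>\<^sup>2)))"
        using M0 by (intro mult_left_mono low) auto
      also have "\<dots> = 16 * M / cmod \<zeta> * cmod (g (\<zeta>\<^sup>2))"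
        using pos by (simp add: power2_eq_square)
      also have "\<dots> \<le> 16 * M / real N * cmod (g (\<zeta>\<^sup>2))"
        using M0 N N0 pos by (intro mult_right_mono divide_left_mono) auto
      finally have "cmod (f (\<zeta>\<^sup>2) - g (\<zeta>\<^sup>2)) / cmod (g (\<zeta>\<^sup>2)) \<le> 16 * M / real N"
        using g0 by (simp add: pos_divide_le_eq)
      moreover have "H \<zeta> = (f (\<zeta>\<^sup>2) - g (\<zeta>\<^sup>2)) / g (\<zeta>\<^sup>2)"
        using g0 by (simp add: H_def hq diff_divide_distrib)
      ultimately show "cmod (H \<zeta>) \<le> 16 * M / real N"
        by (simp add: norm_divide)
    qed auto
  qed
  have H0: "H \<rho> = 0" for \<rho>
  proof -
    obtain K where K: "max (8 * M) (cmod \<rho>) \<le> real K" using real_arch_simple by blast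
    have "(\<lambda>N. 16 * M / real N) \<longlonglongrightarrow> 0"
      by (rule lim_const_over_n)
    moreover have "\<forall>\<^sub>F N in sequentially. cmod (H \<rho>) \<le> 16 * M / real N"
      using eventually_ge_at_top[of "Suc K"]
    proof eventually_elim
      case (elim N)
      then have "real K \<le> real N" "0 < N" by auto
      with K show ?case by (intro small) auto
    qed
    ultimately have "cmod (H \<rho>) \<le> 0"
      by (rule tendsto_lowerbound) simp
    then show ?thesis by simp
  qed
  have eq: "f z = g z" if "g z \<noteq> 0" for z
    using H0[of "csqrt z"] hq[OF that] that by (simp add: H_def)
  show ?thesis
  proof (cases "g z = 0")
    case True
    have an: "f analytic_on {z}" "g analytic_on {z}"
      using f g by (auto simp: analytic_on_open[symmetric] intro: analytic_on_subset)
    have "0 < zorder g z"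
      using True by (subst zorder_pos_iff'[OF an(2)]) (use True in \<open>auto intro: entire_frequently_nonzero[OF g uv(2)]\<close>)
    then have "0 < zorder f z" using zo[of z] by simp
    then have "f z = 0"
      by (subst (asm) zorder_pos_iff'[OF an(1)]) (auto intro: entire_frequently_nonzero[OF f uv(1)])
    then show ?thesis using True by simp
  qed (rule eq)
qed

section \<open>Totality of the sine system\<close>

text \<open>
  The identity \<open>2 cos t cos (n t) = cos ((n + 1) t) + cos ((n - 1) t)\<close> trades one power of \<open>cos t\<close> for
  a shift of \<open>n\<close>.  Hence orthogonality to all \<open>cos (n t)\<close> implies orthogonality to all powers of
  \<open>cos t\<close>, without introducing Chebyshev polynomials.
\<close>
lemma cos_moments_vanish:
  assumes w: "integrable lborel w" and z: "\<And>n::nat. (\<integral>t. w t * of_real (cos (n * t)) \<partial>lborel) = (0::complex)"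
  shows "(\<integral>t. w t * of_real (cos t ^ k * cos (real n * t)) \<partial>lborel) = 0"
proof (induction k arbitrary: n)
  case 0
  show ?case using z by simp
next
  case (Suc k)
  have [measurable]: "w \<in> borel_measurable borel" using w by auto
  have I: "integrable lborel (\<lambda>t. w t * of_real (cos t ^ k * cos (real m * t)))" for m
  proof (rule Bochner_Integration.integrable_bound[OF w])
    have "\<bar>cos t ^ k * cos (real m * t)\<bar> \<le> 1" for t
      unfolding abs_mult power_abs by (intro mult_le_one power_le_one) auto
    then show "AE t in lborel. norm (w t * of_real (cos t ^ k * cos (real m * t))) \<le> norm (w t)"
      by (intro AE_I2) (simp add: norm_mult mult_left_le del: of_real_mult of_real_power)
  qed measurable
  show ?case
  proof (cases n)
    case 0
    then show ?thesis using Suc.IH[of 1] by (simp add: mult.commute)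
  next
    case (Suc m)
    have "cos t ^ Suc k * cos (real n * t) =
        (cos t ^ k * cos (real (Suc n) * t) + cos t ^ k * cos (real m * t)) / 2" for t
    proof -
      have "cos (real (Suc n) * t) + cos (real m * t) = 2 * (cos t * cos (real n * t))"
        using cos_add[of "real n * t" t] cos_diff[of "real n * t" t] Suc
        by (simp add: algebra_simps)
      then show ?thesis
        by (simp add: distrib_left[symmetric])
    qed
    then have "(\<lambda>t. w t * of_real (cos t ^ Suc k * cos (real n * t))) =
      (\<lambda>t. (w t * of_real (cos t ^ k * cos (real (Suc n) * t)) + w t * of_real (cos t ^ k * cos (real m * t))) / 2)"
      by (simp add: algebra_simps add_divide_distrib del: of_nat_Suc)
    then show ?thesis
      using Suc.IH[of "Suc n"] Suc.IH[of m] I[of "Suc n"] I[of m]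
      by (simp only: integral_divide_zero Bochner_Integration.integral_add) simp
  qed
qed

text \<open>
  On \<open>[0, \<pi>]\<close> a continuous function is a continuous function of \<open>cos t\<close>, which is uniformly close to
  a polynomial in \<open>cos t\<close> by Weierstrass' theorem.
\<close>
lemma continuous_moments_vanish:
  fixes w :: "real \<Rightarrow> complex" and f :: "real \<Rightarrow> real"
  assumes w: "integrable lborel w" and supp: "\<And>t. t \<notin> {0..pi} \<Longrightarrow> w t = 0"
    and z: "\<And>k. (\<integral>t. w t * of_real (cos t ^ k) \<partial>lborel) = 0"
    and f: "continuous_on UNIV f"
  shows "(\<integral>t. w t * of_real (f t) \<partial>lborel) = 0"
proof -
  have [measurable]: "w \<in> borel_measurable borel" using w by auto
  have [measurable]: "f \<in> borel_measurable borel" using f by (rule borel_measurable_continuous_onI)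
  let ?W = "\<integral>t. norm (w t) \<partial>lborel"
  have "norm (\<integral>t. w t * of_real (f t) \<partial>lborel) \<le> e * ?W" if e: "0 < e" for e
  proof -
    have "continuous_on {-1..1} (\<lambda>x. f (arccos x))"
      by (rule continuous_on_compose2[OF f continuous_on_arccos']) auto
    then obtain g where g: "real_polynomial_function g" "\<And>x. x \<in> {-1..1} \<Longrightarrow> \<bar>f (arccos x) - g x\<bar> < e"
      using Stone_Weierstrass_real_polynomial_function[OF compact_Icc _ e] by blast
    obtain a n where gs: "g = (\<lambda>x. \<Sum>i\<le>n. a i * x ^ i)"
      using g(1) unfolding real_polynomial_function_iff_sum by blast
    have Ik: "integrable lborel (\<lambda>t. w t * of_real (cos t ^ k))" for k
    proof (rule Bochner_Integration.integrable_bound[OF w])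
      have "\<bar>cos t ^ k\<bar> \<le> 1" for t :: real
        unfolding power_abs by (intro power_le_one) auto
      then show "AE t in lborel. norm (w t * of_real (cos t ^ k)) \<le> norm (w t)"
        by (intro AE_I2) (simp add: norm_mult mult_left_le del: of_real_power)
    qed measurable
    have exp: "w t * of_real (g (cos t)) = (\<Sum>i\<le>n. of_real (a i) * (w t * of_real (cos t ^ i)))" for t
      by (simp add: gs sum_distrib_left mult_ac)
    have Ig: "integrable lborel (\<lambda>t. w t * of_real (g (cos t)))"
      unfolding exp by (intro Bochner_Integration.integrable_sum integrable_mult_right Ik)
    have zg: "(\<integral>t. w t * of_real (g (cos t)) \<partial>lborel) = 0"
      unfolding exp by (subst Bochner_Integration.integral_sum) (auto intro!: integrable_mult_right Ik simp: z simp del: of_real_power)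
    have bd: "norm (w t * of_real (f t) - w t * of_real (g (cos t))) \<le> e * norm (w t)" for t
    proof (cases "t \<in> {0..pi}")
      case True
      then have "\<bar>f t - g (cos t)\<bar> \<le> e"
        using g(2)[of "cos t"] by (simp add: arccos_cos)
      then have "cmod (of_real (f t - g (cos t))) \<le> e"
        by (simp only: norm_of_real)
      then have "norm (w t) * cmod (of_real (f t - g (cos t))) \<le> norm (w t) * e"
        by (intro mult_left_mono) auto
      then show ?thesis
        by (simp add: right_diff_distrib[symmetric] norm_mult mult.commute)
    qed (simp add: supp)
    have Id: "integrable lborel (\<lambda>t. w t * of_real (f t) - w t * of_real (g (cos t)))"
    proof (rule Bochner_Integration.integrable_bound)
      show "integrable lborel (\<lambda>t. e * norm (w t))" using w by simp
      show "AE t in lborel. norm (w t * of_real (f t) - w t * of_real (g (cos t))) \<le> norm (e * norm (w t))"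
        using bd e by (intro AE_I2) (simp add: abs_mult)
      show "(\<lambda>t. w t * of_real (f t) - w t * of_real (g (cos t))) \<in> borel_measurable lborel"
        using borel_measurable_integrable[OF Ig] by measurable
    qed
    have "(\<integral>t. w t * of_real (f t) \<partial>lborel) =
        (\<integral>t. (w t * of_real (f t) - w t * of_real (g (cos t))) + w t * of_real (g (cos t)) \<partial>lborel)"
      by simp
    also have "\<dots> = (\<integral>t. w t * of_real (f t) - w t * of_real (g (cos t)) \<partial>lborel)"
      using Bochner_Integration.integral_add[OF Id Ig] zg by simp
    also have "norm \<dots> \<le> (\<integral>t. norm (w t * of_real (f t) - w t * of_real (g (cos t))) \<partial>lborel)"
      by (rule integral_norm_bound)
    also have "\<dots> \<le> (\<integral>t. e * norm (w t) \<partial>lborel)"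
      using Id w bd by (intro integral_mono) auto
    finally show ?thesis by simp
  qed
  note est = this
  have "((\<lambda>e. e * ?W) \<longlongrightarrow> 0 * ?W) (at_right 0)"
    by (intro tendsto_intros)
  moreover have "\<forall>\<^sub>F e in at_right 0. norm (\<integral>t. w t * of_real (f t) \<partial>lborel) \<le> e * ?W"
    using est by (auto simp: eventually_at_right_field intro: exI[of _ 1])
  ultimately have "norm (\<integral>t. w t * of_real (f t) \<partial>lborel) \<le> 0 * ?W"
    by (rule tendsto_lowerbound) simp
  then show ?thesis by simp
qed

text \<open>
  Indicators of open rays are bounded pointwise limits of continuous functions.  Rays form an
  intersection-stable generator of the Borel sets, so the integral vanishes over every Borel set.
\<close>
lemma AE_zero_of_continuous_moments:
  fixes w :: "real \<Rightarrow> complex"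
  assumes w: "integrable lborel w"
    and z: "\<And>f. continuous_on UNIV f \<Longrightarrow> (\<integral>t. w t * of_real (f t) \<partial>lborel) = 0"
  shows "AE t in lborel. w t = 0"
proof -
  have [measurable]: "w \<in> borel_measurable borel" using w by auto
  have ray: "(LINT t:{a<..}|lborel. w t) = 0" for a
  proof -
    define f :: "nat \<Rightarrow> real \<Rightarrow> real" where "f n t = max 0 (min 1 (real n * (t - a)))" for n t
    have "(\<lambda>n. \<integral>t. w t * of_real (f n t) \<partial>lborel) \<longlonglongrightarrow> (\<integral>t. indicator {a<..} t *\<^sub>R w t \<partial>lborel)"
    proof (rule integral_dominated_convergence[where w = "\<lambda>t. norm (w t)"])
      show "integrable lborel (\<lambda>t. norm (w t))" using w by simp
      show "AE t in lborel. norm (w t * of_real (f n t)) \<le> norm (w t)" for n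
        by (intro AE_I2) (auto simp: f_def norm_mult intro!: mult_left_le)
      have "(\<lambda>n. f n t) \<longlonglongrightarrow> indicator {a<..} t" for t
      proof (cases "a < t")
        case True
        obtain K where K: "1 / (t - a) \<le> real K" using real_arch_simple by blast
        have "\<forall>\<^sub>F n in sequentially. f n t = 1"
          using eventually_ge_at_top[of K]
        proof eventually_elim
          case (elim n)
          then have "1 / (t - a) \<le> real n" using K by linarith
          then have "1 \<le> real n * (t - a)" using True by (simp add: field_simps)
          then show ?case by (simp add: f_def)
        qed
        then show ?thesis using True by (simp add: tendsto_eventually)
      next
        case False
        then have "f n t = 0" for n
          using mult_nonneg_nonpos[of "real n" "t - a"] by (simp add: f_def)
        then show ?thesis using False by simp
      qed
      then have "(\<lambda>n. w t * of_real (f n t)) \<longlonglongrightarrow> w t * of_real (indicator {a<..} t)" for t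
        by (intro tendsto_intros)
      then show "AE t in lborel. (\<lambda>n. w t * of_real (f n t)) \<longlonglongrightarrow> indicator {a<..} t *\<^sub>R w t"
        by (intro AE_I2) (simp add: scaleR_conv_of_real mult.commute)
    qed (auto simp: f_def)
    moreover have "(\<integral>t. w t * of_real (f n t) \<partial>lborel) = 0" for n
      unfolding f_def by (intro z continuous_intros)
    ultimately show ?thesis
      by (simp add: set_lebesgue_integral_def LIMSEQ_const_iff)
  qed
  have si: "set_integrable lborel A w" if "A \<in> sets borel" for A
    unfolding set_integrable_def using that by (intro integrable_mult_indicator w) auto
  have all: "(LINT t:A|lborel. w t) = 0" if "A \<in> sets borel" for A
  proof -
    have "Int_stable (range (greaterThan :: real \<Rightarrow> real set))"
    proof (rule Int_stableI_image)
      fix a b :: real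
      show "\<exists>c\<in>UNIV. {a<..} \<inter> {b<..} = {c<..}"
        by (rule bexI[of _ "max a b"]) auto
    qed
    moreover have "range greaterThan \<subseteq> Pow (UNIV :: real set)" by simp
    moreover have "A \<in> sigma_sets UNIV (range greaterThan)"
      using that by (simp add: borel_Ioi)
    ultimately show ?thesis
    proof (induction A rule: sigma_sets_induct_disjoint)
      case (basic A)
      then show ?case using ray by auto
    next
      case empty
      show ?case by (simp add: set_lebesgue_integral_def)
    next
      case (compl A)
      then have A: "A \<in> sets borel" by (simp add: borel_Ioi)
      have "(LINT t:UNIV|lborel. w t) = 0"
        using z[of "\<lambda>_. 1"] by (simp add: set_lebesgue_integral_def)
      moreover have "(LINT t:UNIV|lborel. w t) = (LINT t:UNIV - A|lborel. w t) + (LINT t:A|lborel. w t)"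
        using set_integral_Un[of "UNIV - A" A lborel w] si[of "UNIV - A"] si[OF A] A by (simp add: Diff_disjoint Int_commute)
      ultimately show ?case using compl by simp
    next
      case (union A)
      then have A: "A i \<in> sets borel" for i by (auto simp: borel_Ioi)
      have "(LINT t:(\<Union>i. A i)|lborel. w t) = (\<Sum>i. LINT t:A i|lborel. w t)"
        by (rule lebesgue_integral_countable_add)
           (use A union in \<open>auto simp: disjoint_family_on_def intro!: si\<close>)
      then show ?case using union by simp
    qed
  qed
  show ?thesis
    by (rule sigma_finite_measure.density_zero[OF _ w]) (use all in \<open>auto intro: sigma_finite_lborel\<close>)
qed

text \<open>
  Since \<open>2 sin t cos (n t) = sin ((n + 1) t) - sin ((n - 1) t)\<close>, the function \<open>p t sin t\<close> is
  orthogonal to all cosines, and \<open>sin t\<close> does not vanish on \<open>(0, \<pi>)\<close>.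
\<close>
lemma sine_system_total:
  fixes p :: "real \<Rightarrow> complex"
  assumes p: "integrable lborel p"
    and z: "\<And>n. n \<ge> 1 \<Longrightarrow> (LINT t:{0<..<pi}|lborel. p t * of_real (sin (real n * t))) = 0"
  shows "AE t in lborel. t \<in> {0<..<pi} \<longrightarrow> p t = 0"
proof -
  define w where "w t = indicator {0<..<pi} t *\<^sub>R (p t * of_real (sin t))" for t
  have [measurable]: "p \<in> borel_measurable borel" using p by auto
  have Is: "integrable lborel (\<lambda>t. indicator {0<..<pi} t *\<^sub>R (p t * of_real (sin (real n * t))))" for n
  proof (rule Bochner_Integration.integrable_bound[OF p])
    show "AE t in lborel. norm (indicator {0<..<pi} t *\<^sub>R (p t * of_real (sin (real n * t)))) \<le> norm (p t)"
      by (intro AE_I2) (auto simp: norm_mult indicator_def intro!: mult_left_le)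
  qed measurable
  have w: "integrable lborel w"
    using Is[of 1] by (simp add: w_def[abs_def])
  have z': "(\<integral>t. indicator {0<..<pi} t *\<^sub>R (p t * of_real (sin (real n * t))) \<partial>lborel) = 0" for n
    using z[of n] by (cases "n = 0") (auto simp: set_lebesgue_integral_def)
  have c: "(\<integral>t. w t * of_real (cos (real n * t)) \<partial>lborel) = 0" for n
  proof (cases n)
    case 0
    then show ?thesis using z'[of 1] by (simp add: w_def)
  next
    case (Suc m)
    have "sin t * cos (real n * t) = (sin (real (Suc n) * t) - sin (real m * t)) / 2" for t
      using sin_add[of "real n * t" t] sin_diff[of "real n * t" t] Suc
      by (simp add: algebra_simps)
    then have "(\<lambda>t. w t * of_real (cos (real n * t))) =
      (\<lambda>t. (indicator {0<..<pi} t *\<^sub>R (p t * of_real (sin (real (Suc n) * t))) -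
         indicator {0<..<pi} t *\<^sub>R (p t * of_real (sin (real m * t)))) / 2)"
      by (simp add: w_def scaleR_conv_of_real mult.assoc right_diff_distrib diff_divide_distrib
          flip: of_real_mult del: of_nat_Suc)
    then show ?thesis
      by (simp only: integral_divide_zero Bochner_Integration.integral_diff[OF Is Is] z') simp
  qed
  have "AE t in lborel. w t = 0"
  proof (rule AE_zero_of_continuous_moments[OF w continuous_moments_vanish[OF w]])
    show "(\<integral>t. w t * of_real (cos t ^ k) \<partial>lborel) = 0" for k
      using cos_moments_vanish[OF w c, of k 0] by simp
  qed (auto simp: w_def)
  then show ?thesis
  proof eventually_elim
    case (elim t)
    then show ?case using sin_gt_zero[of t] by (auto simp: w_def)
  qed
qed

section \<open>Uniqueness of the potential\<close>

lemma volterra_sfun_at_integer: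
  assumes p: "integrable lborel p" and n: "n \<ge> 1"
  shows "volterra p (sfun (of_nat n)) pi =
    - (of_real (cos (real n * pi)) / of_nat n) * (LINT t:{0<..<pi}|lborel. p t * of_real (sin (real n * t)))"
proof -
  have "sin (real n * (pi - t)) = - cos (real n * pi) * sin (real n * t)" for t
    using sin_diff[of "real n * pi" "real n * t"] by (simp add: right_diff_distrib sin_npi)
  then have "sin (of_nat n * of_real (pi - t)) = (of_real (- cos (real n * pi) * sin (real n * t)) :: complex)" for t
    by (metis of_real_mult of_real_of_nat_eq sin_of_real)
  then have "p t * sfun (of_nat n) (pi - t) =
      - (of_real (cos (real n * pi)) / of_nat n) * (p t * of_real (sin (real n * t)))" for t
    using n by (simp add: sfun_def)
  then show ?thesis
    unfolding volterra_def by (simp only: set_integral_mult_right)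
qed

lemma interaction_at_integer:
  assumes "n \<ge> 1"
  shows "interaction p (of_nat n) a = sfun (of_nat n) a * volterra p (sfun (of_nat n)) pi"
proof -
  have "sin (of_nat n * of_real pi) = (0 :: complex)"
    by (metis of_real_0 of_real_mult of_real_of_nat_eq sin_npi sin_of_real)
  then show ?thesis using assms by (simp add: interaction_def sfun_def)
qed

text \<open>
  At a point that is not a zero of the characteristic function both sides are 0 because its order
  is; a zero is an eigenvalue by \<open>eigenvalueI_char_fun_zero\<close>.
\<close>
lemma spectrum_mult_eq_zorder:
  assumes a: "0 < a1" "a1 < a2" "a2 < pi"
    and p: "integrable lborel p" "AE x in lebesgue_on {0<..<pi}. q x = p x"
    and nz: "char_fun q a1 a2 u \<noteq> 0"
  shows "int (spectrum_mult q a1 a2 l) = zorder (char_fun q a1 a2) l"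
proof -
  let ?f = "char_fun q a1 a2"
  have h: "?f holomorphic_on UNIV"
    by (rule char_fun_holomorphic[OF _ _ p]) (use a in auto)
  then have an: "?f analytic_on {l}"
    by (auto simp: analytic_on_open[symmetric] intro: analytic_on_subset)
  have fr: "frequently (\<lambda>x. ?f x \<noteq> 0) (at l)"
    using h nz by (rule entire_frequently_nonzero)
  show ?thesis
  proof (cases "?f l = 0")
    case True
    then have "eigenvalue q a1 a2 l"
      by (rule eigenvalueI_char_fun_zero[OF a p])
    then show ?thesis
      using zorder_ge_0[OF an fr] by (simp add: spectrum_mult_def)
  next
    case False
    then have "zorder ?f l = 0"
      using zorder_eq_0_iff[OF an fr] by simp
    then show ?thesis by (simp add: spectrum_mult_def)
  qed
qed

lemma char_fun_determined_by_spectrum: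
  assumes a: "0 < a1" "a1 < a2" "a2 < pi"
    and p: "integrable lborel p" "AE x in lebesgue_on {0<..<pi}. q x = p x"
    and p': "integrable lborel p'" "AE x in lebesgue_on {0<..<pi}. q' x = p' x"
    and s: "spectrum_mult q a1 a2 = spectrum_mult q' a1 a2"
  shows "char_fun q a1 a2 l = char_fun q' a1 a2 l"
proof -
  define M where "M = 2 * ((\<integral>t. norm (p t) \<partial>lborel) + (\<integral>t. norm (p' t) \<partial>lborel))"
  have bound: "cmod (char_fun q a1 a2 (\<rho>\<^sup>2) - sfun \<rho> pi) \<le> M * (exp (pi * \<bar>Im \<rho>\<bar>) / (cmod \<rho>)\<^sup>2)"
    if p: "integrable lborel p" "AE x in lebesgue_on {0<..<pi}. q x = p x" "\<rho> \<noteq> 0"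
      and M: "2 * (\<integral>t. norm (p t) \<partial>lborel) \<le> M" for q p \<rho>
  proof -
    let ?e = "exp (pi * \<bar>Im \<rho>\<bar>) / (cmod \<rho>)\<^sup>2"
    have "char_fun q a1 a2 (\<rho>\<^sup>2) - sfun \<rho> pi = interaction p \<rho> a1 + interaction p \<rho> a2"
      using char_fun_eq_interactions[OF _ _ _ p(2), of a1 a2 \<rho>] p(1) a by simp
    also have "cmod \<dots> \<le> (\<integral>t. norm (p t) \<partial>lborel) * ?e + (\<integral>t. norm (p t) \<partial>lborel) * ?e"
      by (intro order_trans[OF norm_triangle_ineq] add_mono interaction_bound p) (use a in auto)
    also have "\<dots> = 2 * (\<integral>t. norm (p t) \<partial>lborel) * ?e" by simp
    also have "\<dots> \<le> M * ?e"
      by (intro mult_right_mono M) auto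
    finally show ?thesis .
  qed
  have b: "cmod (char_fun q a1 a2 (\<rho>\<^sup>2) - sfun \<rho> pi) \<le> M * (exp (pi * \<bar>Im \<rho>\<bar>) / (cmod \<rho>)\<^sup>2)" if "\<rho> \<noteq> 0" for \<rho>
    by (rule bound[OF p that]) (simp add: M_def)
  have b': "cmod (char_fun q' a1 a2 (\<rho>\<^sup>2) - sfun \<rho> pi) \<le> M * (exp (pi * \<bar>Im \<rho>\<bar>) / (cmod \<rho>)\<^sup>2)" if "\<rho> \<noteq> 0" for \<rho>
    by (rule bound[OF p' that]) (simp add: M_def)
  have h: "char_fun q a1 a2 holomorphic_on UNIV"
    by (rule char_fun_holomorphic[OF _ _ p]) (use a in auto)
  have h': "char_fun q' a1 a2 holomorphic_on UNIV"
    by (rule char_fun_holomorphic[OF _ _ p']) (use a in auto)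
  have z: "zorder (char_fun q' a1 a2) z \<le> zorder (char_fun q a1 a2) z"
    if "\<exists>u. char_fun q a1 a2 u \<noteq> 0" "\<exists>v. char_fun q' a1 a2 v \<noteq> 0" for z
    using that spectrum_mult_eq_zorder[OF a p, of _ z] spectrum_mult_eq_zorder[OF a p', of _ z] s
    by fastforce
  show ?thesis
    by (rule entire_eq_by_zeros_and_asymptotics[OF h h' b b' z])
qed

theorem theorem2p2:
  fixes a1 a2 :: real and q q' :: "real \<Rightarrow> complex"
  assumes "0 < a1" and "a1 < a2" and "a2 < pi"
    and "L2_0_pi q" and "L2_0_pi q'"
    and "{\<rho>. G2 a1 a2 \<rho> = 0} \<inter> of_nat ` {1..} = {}"
    and "spectrum_mult q a1 a2 = spectrum_mult q' a1 a2"
  shows "AE x in lebesgue_on {0<..<pi}. q x = q' x"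
proof -
  obtain p where pb: "p \<in> borel_measurable borel" and p: "integrable lborel p"
      "AE x in lebesgue_on {0<..<pi}. q x = p x"
    using L2_borel_representative[OF assms(4)] by blast
  obtain p' where pb': "p' \<in> borel_measurable borel" and p': "integrable lborel p'"
      "AE x in lebesgue_on {0<..<pi}. q' x = p' x"
    using L2_borel_representative[OF assms(5)] by blast
  have "(LINT t:{0<..<pi}|lborel. (p t - p' t) * of_real (sin (real n * t))) = 0" if n: "n \<ge> 1" for n
  proof -
    let ?n = "of_nat n :: complex"
    let ?P = "\<lambda>p. LINT t:{0<..<pi}|lborel. p t * of_real (sin (real n * t))"
    \<comment> \<open>At \<open>\<rho> = n\<close> only the terms with the factor \<open>I \<pi>\<close> remain.\<close>
    have "G2 a1 a2 ?n \<noteq> 0"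
      using assms(6) n by auto
    then have G: "sfun ?n a1 + sfun ?n a2 \<noteq> 0"
      using n by (simp add: G2_def sfun_def add_divide_distrib[symmetric])
    have "interaction p ?n a1 + interaction p ?n a2 = interaction p' ?n a1 + interaction p' ?n a2"
      using char_fun_determined_by_spectrum[OF assms(1-3) p p' assms(7), of "?n\<^sup>2"]
        char_fun_eq_interactions[OF _ _ pb p(2), of a1 a2 ?n]
        char_fun_eq_interactions[OF _ _ pb' p'(2), of a1 a2 ?n] assms(1-3)
      by simp
    then have "(sfun ?n a1 + sfun ?n a2) * volterra p (sfun ?n) pi =
        (sfun ?n a1 + sfun ?n a2) * volterra p' (sfun ?n) pi"
      by (simp only: interaction_at_integer[OF n] distrib_right)
    then have "volterra p (sfun ?n) pi = volterra p' (sfun ?n) pi"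
      using G by simp
    moreover have "cos (real n * pi) \<noteq> 0"
      by (simp add: cos_npi)
    ultimately have "?P p = ?P p'"
      using n by (simp add: volterra_sfun_at_integer p(1) p'(1))
    moreover have "set_integrable lborel {0<..<pi} (\<lambda>t. r t * of_real (sin (real n * t)))"
      if r: "integrable lborel r" for r :: "real \<Rightarrow> complex"
      unfolding set_integrable_def
    proof (rule Bochner_Integration.integrable_bound[OF r])
      have [measurable]: "r \<in> borel_measurable borel" using r by auto
      show "(\<lambda>t. indicator {0<..<pi} t *\<^sub>R (r t * of_real (sin (real n * t)))) \<in> borel_measurable lborel"
        by measurable
      show "AE t in lborel. norm (indicator {0<..<pi} t *\<^sub>R (r t * of_real (sin (real n * t)))) \<le> norm (r t)"
        by (intro AE_I2) (auto simp: norm_mult indicator_def intro!: mult_left_le)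
    qed
    ultimately show ?thesis
      using p(1) p'(1) by (simp add: left_diff_distrib set_integral_diff)
  qed
  then have "AE t in lborel. t \<in> {0<..<pi} \<longrightarrow> p t - p' t = 0"
    using p(1) p'(1) by (intro sine_system_total) auto
  then have "AE t in lebesgue. t \<in> {0<..<pi} \<longrightarrow> p t - p' t = 0"
    by (rule AE_completion)
  then have "AE t in lebesgue_on {0<..<pi}. p t = p' t"
    by (simp add: AE_restrict_space_iff)
  with p(2) p'(2) show ?thesis
    by eventually_elim simp
qed

end
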